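(* Let $A$ be a subset of a metric space $X$. (1) If $L^*(A)<\infty$, then for all $\varepsilon>0$ there exists a finite collection $\mathscr{U}$ of open sets in $X$ hit by $A$ such that for any connected $B\subseteq X$ that hits $\mathscr{U}$, $L^*(A)<L^*(B)+\varepsilon$. (2) If $L^*(A)=\infty$, then for all $M>0$ there exists a finite collection $\mathscr{U}$ of open sets in $X$ hit by $A$ such that for any connected $B\subseteq X$ that hits $\mathscr{U}$, $L^*(B)>M$.
   Context: A set $A$ hits a collection $\mathscr{U}$ of sets (and $\mathscr{U}$ is hit by $A$) if $A\cap U\neq\emptyset$ for all $U\in\mathscr{U}$. Outer linear measure on a metric space $(X,d)$ (with $\sup\emptyset=0$, $\inf\emptyset=\infty$): for $A\subseteq X$, $\operatorname{diam}(A)=\sup\{d(a_1,a_2): a_1,a_2\in A\}$. A countable family $\{U_i: i\in\mathbb{N}\}$ of subsets of $X$ is a $\delta$-cover of $A$ if $\operatorname{diam}(U_i)\le\delta$ for all $i$ and $A\subseteq\bigcup_i U_i$. For $\delta>0$, $L^*_\delta(A)=\inf\{\sum_{i\in\mathbb{N}}\operatorname{diam}(U_i): \{U_i: i\in\mathbb{N}\}\text{ is a }\delta\text{-cover of }A\}$, and $L^*(A)=\sup_{\delta>0}L^*_\delta(A)=\lim_{\delta\to0}L^*_\delta(A)\in[0,\infty]$. *)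

theory Defs
  imports "HOL-Analysis.Analysis"
begin

definition hits :: "'a set \<Rightarrow> 'a set set \<Rightarrow> bool" where
  "hits A \<U> \<longleftrightarrow> (\<forall>U\<in>\<U>. A \<inter> U \<noteq> {})"

text \<open>The library's real-valued \<^const>\<open>diameter\<close> is unspecified on unbounded sets, so the
  diameter is taken in the extended nonnegative reals. There \<open>Sup {} = 0\<close> and \<open>Inf {} = \<infinity>\<close>.\<close>

definition ediam :: "'a::metric_space set \<Rightarrow> ennreal" where
  "ediam A = (SUP (x, y) \<in> A \<times> A. ennreal (dist x y))"

definition delta_cover :: "real \<Rightarrow> 'a::metric_space set \<Rightarrow> (nat \<Rightarrow> 'a set) \<Rightarrow> bool" where
  "delta_cover \<delta> A U \<longleftrightarrow> (\<forall>i. ediam (U i) \<le> ennreal \<delta>) \<and> A \<subseteq> (\<Union>i. U i)"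

definition outer_linear_measure_delta :: "real \<Rightarrow> 'a::metric_space set \<Rightarrow> ennreal" where
  "outer_linear_measure_delta \<delta> A = (INF U \<in> {U. delta_cover \<delta> A U}. (\<Sum>i. ediam (U i)))"

definition outer_linear_measure :: "'a::metric_space set \<Rightarrow> ennreal" where
  "outer_linear_measure A = (SUP \<delta> \<in> {0<..}. outer_linear_measure_delta \<delta> A)"

end

theory Submission
  imports Defs
begin

text \<open>
  Both parts say that \<open>L\<^sup>*\<close> is lower semicontinuous at \<open>A\<close> along connected sets: if
  \<open>M < L\<^sup>*(A)\<close>, then some finite family of open sets hit by \<open>A\<close> forces \<open>M < L\<^sup>*(B)\<close> for every
  connected \<open>B\<close> that hits it. The family consists of small balls around finitely many points
  of \<open>A\<close>.

  The heart of the matter is that a connected set \<open>B\<close> with \<open>L\<^sup>*(B) \<le> M\<close> is economically covered by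
  sets that are not too small (lemma \<open>few_pieces\<close>): for every scale \<open>s\<close> and error \<open>\<eta>\<close>, any
  finite subset of \<open>B\<close> is covered by sets of diameter at most \<open>3s\<close>, of total diameter at most
  \<open>M + \<eta>\<close>, whose \<^emph>\<open>number\<close> is at most \<open>(M + \<eta>)/s + 1\<close>, a bound that depends neither on the
  finite subset nor on \<open>B\<close>. An efficient cover of \<open>B\<close> may well use many tiny sets, but since \<open>B\<close>
  is connected, finitely many of them that link up suffice for the given points
  (\<open>linked_subcover_of_finite\<close>), and neighbouring small sets can be merged, almost without
  increasing the sum of the diameters, until each piece accounts for an amount \<open>s\<close> of that sum
  (\<open>linked_merge\<close>).

  Now choose \<open>\<delta>\<close> with \<open>M < L\<^sup>*\<^sub>\<delta>(A)\<close>, a scale \<open>s\<close> comparable to \<open>\<delta>\<close>, and \<open>r\<close> so small that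
  enlarging as many sets as the bound allows by \<open>2r\<close> costs less than \<open>\<eta>\<close>. If \<open>A\<close> has a finite
  \<open>r\<close>-net \<open>F\<close>, and \<open>B\<close> meets the \<open>r\<close>-balls around \<open>F\<close>, then the pieces for nearby points of
  \<open>B\<close>, enlarged by \<open>2r\<close>, form a \<open>\<delta>\<close>-cover of \<open>A\<close> of total diameter at most \<open>M + 2\<eta>\<close>, against the
  choice of \<open>\<delta>\<close> (\<open>outer_linear_measure_delta_le_of_net\<close>). Otherwise \<open>A\<close> has arbitrarily many
  points at mutual distance at least \<open>r\<close>, and the bound on the number of pieces at a scale
  smaller than \<open>r\<close> shows that no connected set with \<open>L\<^sup>*(B) \<le> M\<close> comes close to all of them
  (\<open>many_separated_points\<close>).
\<close>

section \<open>Diameters and thickenings\<close>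

lemma ediam_le_iff:
  assumes "0 \<le> c"
  shows "ediam P \<le> ennreal c \<longleftrightarrow> (\<forall>x\<in>P. \<forall>y\<in>P. dist x y \<le> c)"
  using assms by (auto simp: ediam_def SUP_le_iff ennreal_le_iff)

lemma ediam_empty [simp]: "ediam {} = 0"
  by (simp add: ediam_def bot_ennreal)

definition thicken :: "real \<Rightarrow> 'a::metric_space set \<Rightarrow> 'a set" where
  "thicken e P = (\<Union>p\<in>P. ball p e)"

lemma open_thicken: "open (thicken e P)"
  by (simp add: thicken_def open_UN)

lemma subset_thicken: "0 < e \<Longrightarrow> P \<subseteq> thicken e P"
  by (auto simp: thicken_def)

lemma dist_thicken_le:
  assumes P: "\<And>x y. x \<in> P \<Longrightarrow> y \<in> P \<Longrightarrow> dist x y \<le> c"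
    and "x \<in> thicken e P" "y \<in> thicken e P"
  shows "dist x y \<le> c + 2 * e"
proof -
  obtain p q where p: "p \<in> P" "dist p x < e" and q: "q \<in> P" "dist q y < e"
    using assms(2,3) by (auto simp: thicken_def)
  have "dist x y \<le> dist p x + dist p q + dist q y"
    using dist_triangle[of x y p] dist_triangle[of p y q] by (simp add: dist_commute)
  with P[OF p(1) q(1)] p q show ?thesis by linarith
qed

lemma dist_Un_le:
  assumes P: "\<And>x y. x \<in> P \<Longrightarrow> y \<in> P \<Longrightarrow> dist x y \<le> a"
    and Q: "\<And>x y. x \<in> Q \<Longrightarrow> y \<in> Q \<Longrightarrow> dist x y \<le> b"
    and z: "z \<in> P" "z \<in> Q"
    and xy: "x \<in> P \<union> Q" "y \<in> P \<union> Q"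
  shows "dist x y \<le> a + b"
proof -
  have ab: "0 \<le> a" "0 \<le> b" using P[OF z(1) z(1)] Q[OF z(2) z(2)] by auto
  have tri: "dist x y \<le> dist x z + dist z y" by (rule dist_triangle)
  show ?thesis
    using xy
  proof (elim UnE)
    assume "x \<in> P" "y \<in> P"
    then show ?thesis using P[of x y] ab by linarith
  next
    assume "x \<in> Q" "y \<in> Q"
    then show ?thesis using Q[of x y] ab by linarith
  next
    assume "x \<in> P" "y \<in> Q"
    then show ?thesis using P[of x z] Q[of z y] z tri by linarith
  next
    assume "x \<in> Q" "y \<in> P"
    then show ?thesis using Q[of x z] P[of z y] z tri by linarith
  qed
qed

section \<open>Linked families in a cover of a connected set\<close>

text \<open>A finite index set is linked if its members can be listed so that each, after the first,
  meets an earlier one. This form of connectedness of the intersection graph comes with the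
  induction that removes a leaf of a spanning tree.\<close>

inductive linked :: "('i \<Rightarrow> 'a set) \<Rightarrow> 'i set \<Rightarrow> bool" for U where
  single: "linked U {i}"
| attach: "linked U J \<Longrightarrow> j \<notin> J \<Longrightarrow> k \<in> J \<Longrightarrow> U j \<inter> U k \<noteq> {} \<Longrightarrow> linked U (insert j J)"

lemma finite_linked: "linked U J \<Longrightarrow> finite J"
  by (induction rule: linked.induct) auto

text \<open>The sets that can be reached from \<open>U i\<close> by a chain and those that cannot have disjoint
  open unions, which would separate \<open>B\<close>.\<close>

lemma connected_imp_chain:
  fixes U :: "'i \<Rightarrow> 'a::topological_space set"
  assumes B: "connected B" and op: "\<And>i. open (U i)" and cov: "B \<subseteq> (\<Union>i. U i)"
    and i: "x \<in> B" "x \<in> U i" and j: "y \<in> B" "y \<in> U j"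
  shows "(i, j) \<in> {(k, l). U k \<inter> U l \<noteq> {}}\<^sup>*" (is "_ \<in> ?R\<^sup>*")
proof (rule ccontr)
  assume nj: "(i, j) \<notin> ?R\<^sup>*"
  let ?G = "\<Union>k\<in>{k. (i, k) \<in> ?R\<^sup>*}. U k" and ?H = "\<Union>k\<in>{k. (i, k) \<notin> ?R\<^sup>*}. U k"
  have "?G \<inter> ?H = {}"
  proof (rule ccontr)
    assume "?G \<inter> ?H \<noteq> {}"
    then obtain k l where kl: "(i, k) \<in> ?R\<^sup>*" "(i, l) \<notin> ?R\<^sup>*" "(k, l) \<in> ?R"
      by blast
    then show False by (meson rtrancl.rtrancl_into_rtrancl)
  qed
  moreover have "B \<subseteq> ?G \<union> ?H" using cov by blast
  moreover have "open ?G" "open ?H" using op by auto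
  ultimately have "?G \<inter> B = {} \<or> ?H \<inter> B = {}"
    using connectedD[OF B, of ?G ?H] by blast
  then show False using i j nj by blast
qed

lemma linked_extend:
  assumes "(i, j) \<in> {(k, l). U k \<inter> U l \<noteq> {}}\<^sup>*" and "linked U J" "i \<in> J"
  shows "\<exists>J'. linked U J' \<and> J \<subseteq> J' \<and> j \<in> J'"
  using assms(1)
proof (induction rule: rtrancl_induct)
  case base
  then show ?case using assms by blast
next
  case (step k l)
  then obtain J' where J': "linked U J'" "J \<subseteq> J'" "k \<in> J'" by blast
  show ?case
  proof (cases "l \<in> J'")
    case False
    have "linked U (insert l J')"
      by (rule linked.attach[OF J'(1) False J'(3)]) (use step in auto)
    then show ?thesis using J' by blast
  qed (use J' in blast)
qed

text \<open>A substitute for compactness: an infinite cover of \<open>B\<close> need not have a finite subcover, but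
  finitely many points of \<open>B\<close> are caught by a finite part that is still linked.\<close>

lemma linked_subcover_of_finite:
  fixes U :: "'i \<Rightarrow> 'a::topological_space set"
  assumes B: "connected B" and op: "\<And>i. open (U i)" and cov: "B \<subseteq> (\<Union>i. U i)"
    and F: "finite F" "F \<noteq> {}" "F \<subseteq> B"
  shows "\<exists>J. linked U J \<and> F \<subseteq> (\<Union>i\<in>J. U i)"
  using F
proof (induction rule: finite_ne_induct)
  case (singleton x)
  then obtain i where "x \<in> U i" using cov by blast
  then show ?case using linked.single[of U i] by (intro exI[of _ "{i}"]) auto
next
  case (insert x F)
  then obtain J where J: "linked U J" "F \<subseteq> (\<Union>i\<in>J. U i)" by auto
  obtain y where y: "y \<in> F" using insert by blast
  then obtain i where i: "i \<in> J" "y \<in> U i" using J by blast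
  obtain j where j: "x \<in> U j" using insert cov by blast
  have "(i, j) \<in> {(k, l). U k \<inter> U l \<noteq> {}}\<^sup>*"
    using connected_imp_chain[OF B op cov, of y i x j] insert i j y by blast
  from linked_extend[OF this J(1) i(1)]
  obtain J' where J': "linked U J'" "J \<subseteq> J'" "j \<in> J'" by blast
  have "insert x F \<subseteq> (\<Union>i\<in>J'. U i)" using J(2) J'(2,3) j by auto
  with J'(1) show ?case by blast
qed

section \<open>Merging a linked family into few pieces\<close>

text \<open>Every piece carries a bound for its own diameter; real bounds can be summed and compared
  without converting extended diameters back and forth.\<close>

definition pieces :: "real \<Rightarrow> ('a::metric_space set \<times> real) list \<Rightarrow> bool" where
  "pieces D ps \<longleftrightarrow> (\<forall>(P, c)\<in>set ps. (\<forall>x\<in>P. \<forall>y\<in>P. dist x y \<le> c) \<and> 0 \<le> c \<and> c \<le> D)"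

lemma piecesD:
  assumes "pieces D ps" "p \<in> set ps"
  shows "x \<in> fst p \<Longrightarrow> y \<in> fst p \<Longrightarrow> dist x y \<le> snd p" "0 \<le> snd p" "snd p \<le> D"
  using assms by (auto simp: pieces_def)

lemma pieces_mono: "pieces D ps \<Longrightarrow> D \<le> E \<Longrightarrow> pieces E ps"
  by (fastforce simp: pieces_def)

text \<open>
  The induction takes apart a spanning tree from its leaves. During this process each remaining
  vertex \<open>k\<close> carries the set \<open>Q k\<close> of everything already merged into \<open>U k\<close>, and \<open>\<rho> k < s\<close> is
  the part of the diameter budget collected there on top of \<open>d k\<close>. A leaf \<open>j\<close> is merged into its
  neighbour \<open>k\<close>, which raises the collected budget to \<open>t = \<rho> k + d j + \<rho> j\<close>. If \<open>t < s\<close>,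
  the process goes on. If \<open>t \<ge> s\<close>, the set \<open>Q k \<union> Q j\<close> is put aside as a finished piece and \<open>k\<close>
  starts afresh with \<open>U k\<close> alone.

  Each finished piece uses up at least \<open>s\<close> of the total budget, which bounds the number of
  pieces; the last piece, left at the root, may use less. A finished piece contains \<open>U k\<close>, which
  is used again later, so each piece overcharges the total by at most \<open>\<tau>\<close>. This waste is
  harmless, for \<open>\<tau>\<close> can be chosen small after the number of pieces has been bounded.
\<close>

lemma linked_merge:
  fixes U Q :: "'i \<Rightarrow> 'a::metric_space set" and d \<rho> :: "'i \<Rightarrow> real"
  assumes "linked U J"
    and "\<And>k x y. k \<in> J \<Longrightarrow> x \<in> U k \<Longrightarrow> y \<in> U k \<Longrightarrow> dist x y \<le> d k"
    and "\<And>k. k \<in> J \<Longrightarrow> 0 \<le> d k \<and> d k \<le> \<tau>"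
    and "\<And>k. k \<in> J \<Longrightarrow> U k \<subseteq> Q k"
    and "\<And>k x y. k \<in> J \<Longrightarrow> x \<in> Q k \<Longrightarrow> y \<in> Q k \<Longrightarrow> dist x y \<le> d k + \<rho> k"
    and "\<And>k. k \<in> J \<Longrightarrow> 0 \<le> \<rho> k \<and> \<rho> k < s"
  shows "\<exists>ps. (\<Union>k\<in>J. Q k) \<subseteq> \<Union>(fst ` set ps)
      \<and> pieces (2 * s + 2 * \<tau>) ps
      \<and> sum_list (map snd ps) \<le> (\<Sum>k\<in>J. d k + \<rho> k) + \<tau> * length ps
      \<and> (real (length ps) - 1) * s \<le> (\<Sum>k\<in>J. d k + \<rho> k)"
  using assms
proof (induction arbitrary: Q \<rho> rule: linked.induct)
  case (single i)
  have "d i + \<rho> i \<le> 2 * s + 2 * \<tau>" "0 \<le> d i" "0 \<le> \<rho> i" "0 \<le> \<tau>"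
    using single(2)[of i] single(5)[of i] by auto
  then show ?case
    using single(4)[of i] by (intro exI[of _ "[(Q i, d i + \<rho> i)]"]) (auto simp: pieces_def)
next
  case (attach J j k)
  have fin: "finite J" using attach.hyps(1) by (rule finite_linked)
  define t where "t = \<rho> k + (d j + \<rho> j)"
  have t0: "0 \<le> t"
    using attach.prems(2,5)[of j] attach.prems(5)[of k] attach.hyps by (simp add: t_def)
  obtain z where z: "z \<in> Q j" "z \<in> Q k"
    using attach.hyps attach.prems(3)[of j] attach.prems(3)[of k] by blast
  have QQ: "dist x y \<le> d k + t" if "x \<in> Q k \<union> Q j" "y \<in> Q k \<union> Q j" for x y
    using dist_Un_le[OF attach.prems(4)[of k] attach.prems(4)[of j] z(2) z(1) that] attach.hyps
    by (simp add: t_def)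
  have split: "(\<Sum>l\<in>J. d l + \<rho> l) = (d k + \<rho> k) + (\<Sum>l\<in>J - {k}. d l + \<rho> l)"
    using fin attach.hyps by (simp add: sum.remove)
  have split': "(\<Sum>l\<in>J. d l + (\<rho>(k := r)) l) = (d k + r) + (\<Sum>l\<in>J - {k}. d l + \<rho> l)" for r
    using fin attach.hyps by (simp add: sum.remove)
  have total: "(\<Sum>l\<in>insert j J. d l + \<rho> l) = (\<Sum>l\<in>J. d l + (\<rho>(k := r)) l) + t - r" for r
  proof -
    have "(\<Sum>l\<in>insert j J. d l + \<rho> l) = d j + \<rho> j + (\<Sum>l\<in>J. d l + \<rho> l)"
      using fin attach.hyps by simp
    then show ?thesis unfolding split split' t_def by simp
  qed
  show ?case
  proof (cases "t < s")
    case True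
    have "\<exists>ps. (\<Union>l\<in>J. (Q(k := Q k \<union> Q j)) l) \<subseteq> \<Union>(fst ` set ps)
      \<and> pieces (2 * s + 2 * \<tau>) ps
      \<and> sum_list (map snd ps) \<le> (\<Sum>l\<in>J. d l + (\<rho>(k := t)) l) + \<tau> * length ps
      \<and> (real (length ps) - 1) * s \<le> (\<Sum>l\<in>J. d l + (\<rho>(k := t)) l)"
    proof (rule attach.IH)
      fix l assume "l \<in> J"
      then show "U l \<subseteq> (Q(k := Q k \<union> Q j)) l" using attach.prems(3)[of l] by auto
    next
      fix l x y
      assume "l \<in> J" "x \<in> (Q(k := Q k \<union> Q j)) l" "y \<in> (Q(k := Q k \<union> Q j)) l"
      then show "dist x y \<le> d l + (\<rho>(k := t)) l"
        using attach.prems(4)[of l x y] QQ[of x y] by (cases "l = k") auto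
    next
      fix l assume "l \<in> J"
      then show "0 \<le> (\<rho>(k := t)) l \<and> (\<rho>(k := t)) l < s"
        using attach.prems(5)[of l] t0 True by auto
    qed (use attach.prems in auto)
    moreover have "(\<Union>l\<in>insert j J. Q l) = (\<Union>l\<in>J. (Q(k := Q k \<union> Q j)) l)"
      using attach.hyps by (auto split: if_splits)
    moreover have "(\<Sum>l\<in>J. d l + (\<rho>(k := t)) l) = (\<Sum>l\<in>insert j J. d l + \<rho> l)"
      using total[of t] by simp
    ultimately show ?thesis by simp
  next
    case False
    have "\<exists>ps. (\<Union>l\<in>J. (Q(k := U k)) l) \<subseteq> \<Union>(fst ` set ps)
      \<and> pieces (2 * s + 2 * \<tau>) ps
      \<and> sum_list (map snd ps) \<le> (\<Sum>l\<in>J. d l + (\<rho>(k := 0)) l) + \<tau> * length ps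
      \<and> (real (length ps) - 1) * s \<le> (\<Sum>l\<in>J. d l + (\<rho>(k := 0)) l)"
    proof (rule attach.IH)
      fix l assume "l \<in> J"
      then show "U l \<subseteq> (Q(k := U k)) l" using attach.prems(3)[of l] by auto
    next
      fix l x y
      assume "l \<in> J" "x \<in> (Q(k := U k)) l" "y \<in> (Q(k := U k)) l"
      then show "dist x y \<le> d l + (\<rho>(k := 0)) l"
        using attach.prems(4)[of l x y] attach.prems(1)[of l x y] by (cases "l = k") auto
    next
      fix l assume "l \<in> J"
      then show "0 \<le> (\<rho>(k := 0)) l \<and> (\<rho>(k := 0)) l < s"
        using attach.prems(5)[of l] by auto
    qed (use attach.prems in auto)
    then obtain ps where ps: "(\<Union>l\<in>J. (Q(k := U k)) l) \<subseteq> \<Union>(fst ` set ps)"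
        "pieces (2 * s + 2 * \<tau>) ps"
        "sum_list (map snd ps) \<le> (\<Sum>l\<in>J. d l + (\<rho>(k := 0)) l) + \<tau> * length ps"
        "(real (length ps) - 1) * s \<le> (\<Sum>l\<in>J. d l + (\<rho>(k := 0)) l)"
      by blast
    have dk: "0 \<le> d k" "d k \<le> \<tau>" using attach.prems(2)[of k] attach.hyps by auto
    have c: "d k + t \<le> 2 * s + 2 * \<tau>" "0 \<le> d k + t"
      using attach.prems(2,5)[of j] attach.prems(5)[of k] attach.hyps dk t0 by (auto simp: t_def)
    let ?ps = "(Q k \<union> Q j, d k + t) # ps"
    have "(\<Union>l\<in>insert j J. Q l) \<subseteq> \<Union>(fst ` set ?ps)"
    proof
      fix x assume "x \<in> (\<Union>l\<in>insert j J. Q l)"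
      then have "x \<in> Q k \<union> Q j \<or> x \<in> (\<Union>l\<in>J. (Q(k := U k)) l)"
        by (auto split: if_splits)
      then show "x \<in> \<Union>(fst ` set ?ps)"
      proof
        assume "x \<in> (\<Union>l\<in>J. (Q(k := U k)) l)"
        then have "x \<in> \<Union>(fst ` set ps)" using ps(1) by (rule rev_subsetD)
        then show ?thesis by simp
      qed simp
    qed
    moreover have "pieces (2 * s + 2 * \<tau>) ?ps"
      using ps(2) c QQ by (simp add: pieces_def)
    moreover have "sum_list (map snd ?ps) \<le> (\<Sum>l\<in>insert j J. d l + \<rho> l) + \<tau> * length ?ps"
      using ps(3) dk total[of 0] by (simp add: algebra_simps)
    moreover have "(real (length ?ps) - 1) * s \<le> (\<Sum>l\<in>insert j J. d l + \<rho> l)"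
      using ps(4) False total[of 0] by (simp add: algebra_simps)
    ultimately show ?thesis by blast
  qed
qed

section \<open>Finite subsets of connected sets of small measure\<close>

lemma outer_linear_measure_delta_le:
  "0 < \<delta> \<Longrightarrow> outer_linear_measure_delta \<delta> A \<le> outer_linear_measure A"
  by (auto simp: outer_linear_measure_def intro: SUP_upper)

text \<open>Diameters do not increase by much when the sets of a cover are thickened to open ones, if the
  \<open>i\<close>-th set is thickened by an amount that decays geometrically in \<open>i\<close>.\<close>

lemma small_open_cover:
  assumes B: "outer_linear_measure B \<le> ennreal M" and M: "0 \<le> M" and \<eta>: "0 < \<eta>" and \<tau>: "0 < \<tau>"
  obtains V :: "nat \<Rightarrow> 'a::metric_space set" and d where "\<And>i. open (V i)" "B \<subseteq> (\<Union>i. V i)"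
    "\<And>i x y. x \<in> V i \<Longrightarrow> y \<in> V i \<Longrightarrow> dist x y \<le> d i"
    "\<And>i. 0 \<le> d i" "\<And>i. d i \<le> \<tau>" "\<And>J. finite J \<Longrightarrow> sum d J \<le> M + \<eta>"
proof -
  have "outer_linear_measure_delta (\<tau> / 2) B \<le> ennreal M"
    using outer_linear_measure_delta_le[of "\<tau> / 2" B] B \<tau> by (auto intro: order_trans)
  also have "\<dots> < ennreal (M + \<eta> / 2)"
    using M \<eta> by (simp add: ennreal_less_iff)
  finally obtain U where U: "delta_cover (\<tau> / 2) B U" and sumU: "(\<Sum>i. ediam (U i)) < ennreal (M + \<eta> / 2)"
    by (auto simp: outer_linear_measure_delta_def INF_less_iff)
  define w where "w i = enn2real (ediam (U i))" for i
  have w: "ediam (U i) = ennreal (w i)" "0 \<le> w i" "w i \<le> \<tau> / 2" for i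
  proof -
    have le: "ediam (U i) \<le> ennreal (\<tau> / 2)" using U by (simp add: delta_cover_def)
    then have "ediam (U i) < top" by (rule order.strict_trans1) simp
    then show eq: "ediam (U i) = ennreal (w i)" by (simp add: w_def)
    show "0 \<le> w i" by (simp add: w_def)
    show "w i \<le> \<tau> / 2" using le \<tau> by (simp add: eq ennreal_le_iff)
  qed
  have sumw: "sum w J \<le> M + \<eta> / 2" if "finite J" for J
  proof -
    have "ennreal (sum w J) = (\<Sum>i\<in>J. ediam (U i))" by (simp add: w)
    also have "\<dots> \<le> (\<Sum>i. ediam (U i))" using that by (intro sum_le_suminf) auto
    finally have "ennreal (sum w J) \<le> ennreal (M + \<eta> / 2)" using sumU by simp
    then show ?thesis using M \<eta> by (subst (asm) ennreal_le_iff) auto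
  qed
  define \<mu> where "\<mu> = min \<eta> \<tau>"
  have \<mu>: "0 < \<mu>" "\<mu> \<le> \<eta>" "\<mu> \<le> \<tau>" using \<eta> \<tau> by (auto simp: \<mu>_def)
  define e where "e i = \<mu> / 4 * (1 / 2) ^ Suc i" for i :: nat
  have e: "0 < e i" "e i \<le> \<mu> / 4" for i
    using \<mu>(1) power_le_one[of "1/2::real" "Suc i"] by (auto simp: e_def simp del: power_Suc)
  have sume: "sum e J \<le> \<mu> / 4" if "finite J" for J
  proof -
    have s: "e sums (\<mu> / 4 * 1)" unfolding e_def by (intro sums_mult power_half_series)
    have "sum e J \<le> suminf e"
      using s that e(1) by (intro sum_le_suminf) (auto simp: sums_iff less_imp_le)
    then show ?thesis using s by (simp add: sums_iff)
  qed
  show ?thesis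
  proof
    show "open (thicken (e i) (U i))" for i by (rule open_thicken)
    show "B \<subseteq> (\<Union>i. thicken (e i) (U i))"
    proof -
      have "(\<Union>i. U i) \<subseteq> (\<Union>i. thicken (e i) (U i))"
        using subset_thicken[OF e(1)] by (intro UN_mono) auto
      then show ?thesis using U by (auto simp: delta_cover_def)
    qed
    show "dist x y \<le> w i + 2 * e i" if "x \<in> thicken (e i) (U i)" "y \<in> thicken (e i) (U i)" for i x y
    proof (rule dist_thicken_le[OF _ that])
      show "dist x y \<le> w i" if "x \<in> U i" "y \<in> U i" for x y
        using that w(1)[of i] ediam_le_iff[OF w(2), of "U i" i] by auto
    qed
    show "0 \<le> w i + 2 * e i" for i using w(2)[of i] e(1)[of i] by simp
    show "w i + 2 * e i \<le> \<tau>" for i using w(3)[of i] e(2)[of i] \<mu> by simp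
    show "(\<Sum>i\<in>J. w i + 2 * e i) \<le> M + \<eta>" if "finite J" for J
      using sumw[OF that] sume[OF that] \<mu> by (simp add: sum.distrib flip: sum_distrib_left)
  qed
qed

text \<open>The bound on the number of pieces depends on \<open>B\<close> only through \<open>M\<close>. Hence everything that
  follows can fix its constants before \<open>B\<close> is known.\<close>

lemma few_pieces:
  fixes B :: "'a::metric_space set"
  assumes B: "connected B" and L: "outer_linear_measure B \<le> ennreal M" and M: "0 \<le> M"
    and s: "0 < s" and \<eta>: "0 < \<eta>" and F: "finite F" "F \<subseteq> B"
  shows "\<exists>ps. F \<subseteq> \<Union>(fst ` set ps) \<and> pieces (3 * s) ps
    \<and> sum_list (map snd ps) \<le> M + \<eta> \<and> real (length ps) \<le> (M + \<eta>) / s + 1"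
proof (cases "F = {}")
  case True
  show ?thesis by (rule exI[of _ "[]"]) (use True M \<eta> s in \<open>auto simp: pieces_def\<close>)
next
  case False
  define N where "N = (M + \<eta>) / s + 1"
  have N: "1 \<le> N" using M \<eta> s by (simp add: N_def)
  \<comment> \<open>With at most \<open>N\<close> pieces, this keeps the waste \<open>\<tau> * length ps\<close> of merging below \<open>\<eta> / 2\<close>.\<close>
  define \<tau> where "\<tau> = min (s / 2) (\<eta> / 2 / N)"
  have \<tau>: "0 < \<tau>" "\<tau> \<le> s / 2" "\<tau> \<le> \<eta> / 2 / N" using s \<eta> N by (auto simp: \<tau>_def)
  have \<eta>2: "0 < \<eta> / 2" using \<eta> by simp
  obtain V :: "nat \<Rightarrow> 'a set" and d where V: "\<And>i. open (V i)" "B \<subseteq> (\<Union>i. V i)"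
    "\<And>i x y. x \<in> V i \<Longrightarrow> y \<in> V i \<Longrightarrow> dist x y \<le> d i"
    and d: "\<And>i. 0 \<le> d i" "\<And>i. d i \<le> \<tau>" "\<And>J. finite J \<Longrightarrow> sum d J \<le> M + \<eta> / 2"
    by (fact small_open_cover[OF L M \<eta>2 \<tau>(1)])
  obtain J where J: "linked V J" "F \<subseteq> (\<Union>i\<in>J. V i)"
    using linked_subcover_of_finite[OF B V(1,2) F(1) False F(2)] by blast
  have "\<exists>ps. (\<Union>k\<in>J. V k) \<subseteq> \<Union>(fst ` set ps) \<and> pieces (2 * s + 2 * \<tau>) ps
      \<and> sum_list (map snd ps) \<le> (\<Sum>k\<in>J. d k + 0) + \<tau> * length ps
      \<and> (real (length ps) - 1) * s \<le> (\<Sum>k\<in>J. d k + 0)"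
    by (rule linked_merge[OF J(1)]) (simp_all add: V(3) d(1,2) s)
  then obtain ps where ps: "(\<Union>k\<in>J. V k) \<subseteq> \<Union>(fst ` set ps)" "pieces (2 * s + 2 * \<tau>) ps"
      "sum_list (map snd ps) \<le> sum d J + \<tau> * length ps" "(real (length ps) - 1) * s \<le> sum d J"
    by auto
  note sumd = d(3)[OF finite_linked[OF J(1)]]
  have len: "real (length ps) \<le> N"
  proof -
    have "(real (length ps) - 1) * s \<le> M + \<eta>" using ps(4) sumd \<eta> by linarith
    then show ?thesis using s by (simp add: N_def field_simps)
  qed
  have "\<tau> * length ps \<le> \<eta> / 2 / N * N"
    using \<tau> len N by (intro mult_mono) auto
  then have "sum_list (map snd ps) \<le> M + \<eta>" using ps(3) sumd N by simp
  moreover have "pieces (3 * s) ps" using ps(2) by (rule pieces_mono) (use \<tau> in simp)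
  moreover have "F \<subseteq> \<Union>(fst ` set ps)" using J(2) ps(1) by (rule order_trans)
  ultimately show ?thesis using len unfolding N_def by blast
qed

section \<open>Lower semicontinuity\<close>

text \<open>Pieces of scale \<open>r / 12\<close> have diameter at most \<open>r / 4\<close>. Points of \<open>B\<close> chosen within
  \<open>r / 4\<close> of two different points of \<open>F\<close> are more than \<open>r / 2\<close> apart, so they lie in different
  pieces, and there are too few pieces for that.\<close>

lemma many_separated_points:
  fixes F :: "'a::metric_space set"
  assumes F: "finite F" "\<And>x y. x \<in> F \<Longrightarrow> y \<in> F \<Longrightarrow> x \<noteq> y \<Longrightarrow> r \<le> dist x y"
    and r: "0 < r" and M: "0 \<le> M" and \<eta>: "0 < \<eta>"
    and card: "(M + \<eta>) / (r / 12) + 1 < card F"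
    and B: "connected B" "hits B ((\<lambda>a. ball a (r / 4)) ` F)"
  shows "ennreal M < outer_linear_measure B"
proof (rule ccontr)
  assume "\<not> ennreal M < outer_linear_measure B"
  then have L: "outer_linear_measure B \<le> ennreal M" by simp
  have "\<exists>b. b \<in> B \<and> dist a b < r / 4" if "a \<in> F" for a
  proof -
    have "B \<inter> ball a (r / 4) \<noteq> {}" using B(2) that by (simp add: hits_def)
    then show ?thesis by auto
  qed
  then obtain b where b: "\<And>a. a \<in> F \<Longrightarrow> b a \<in> B \<and> dist a (b a) < r / 4" by metis
  have bF: "finite (b ` F)" "b ` F \<subseteq> B" using F(1) b by auto
  have r12: "0 < r / 12" using r by simp
  obtain ps where ps: "b ` F \<subseteq> \<Union>(fst ` set ps)" "pieces (3 * (r / 12)) ps"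
    "real (length ps) \<le> (M + \<eta>) / (r / 12) + 1"
    using few_pieces[OF B(1) L M r12 \<eta> bF] by blast
  have "\<exists>p. p \<in> set ps \<and> b a \<in> fst p" if "a \<in> F" for a
    using ps(1) that by blast
  then obtain p where p: "\<And>a. a \<in> F \<Longrightarrow> p a \<in> set ps \<and> b a \<in> fst (p a)" by metis
  have "inj_on p F"
  proof (rule inj_onI, rule ccontr)
    fix x y assume xy: "x \<in> F" "y \<in> F" "p x = p y" "x \<noteq> y"
    have px: "p x \<in> set ps" "b x \<in> fst (p x)" "b y \<in> fst (p x)" using p[OF xy(1)] p[OF xy(2)] xy(3) by auto
    have "dist (b x) (b y) \<le> r / 4"
      using piecesD(1)[OF ps(2) px] piecesD(3)[OF ps(2) px(1)] by linarith
    moreover have "dist x y \<le> dist x (b x) + dist (b x) (b y) + dist y (b y)"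
      using dist_triangle[of x y "b x"] dist_triangle[of "b x" y "b y"] by (simp add: dist_commute)
    ultimately have "dist x y < r" using b[OF xy(1)] b[OF xy(2)] r by linarith
    then show False using F(2)[OF xy(1,2,4)] by simp
  qed
  then have "card F \<le> card (set ps)"
    using p by (intro card_inj_on_le) auto
  then have "card F \<le> length ps" using card_length le_trans by blast
  then show False using ps(3) card by linarith
qed

text \<open>If the separated subsets of \<open>A\<close> have bounded size, one of maximal size is a net.\<close>

lemma net_or_many_separated_points:
  fixes A :: "'a::metric_space set"
  assumes "0 < r"
  obtains (net) F where "finite F" "F \<subseteq> A" "\<And>x. x \<in> A \<Longrightarrow> \<exists>a\<in>F. dist a x < r"
  | (separated) F where "finite F" "F \<subseteq> A" "n < card F"
      "\<And>x y. x \<in> F \<Longrightarrow> y \<in> F \<Longrightarrow> x \<noteq> y \<Longrightarrow> r \<le> dist x y"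
proof -
  define S where "S F \<longleftrightarrow> finite F \<and> F \<subseteq> A \<and> (\<forall>x\<in>F. \<forall>y\<in>F. x \<noteq> y \<longrightarrow> r \<le> dist x y)" for F
  show thesis
  proof (cases "\<exists>F. S F \<and> n < card F")
    case True
    then obtain F where F: "S F" "n < card F" by blast
    show ?thesis by (rule separated[of F]) (use F in \<open>auto simp: S_def\<close>)
  next
    case False
    have "S {}" by (simp add: S_def)
    then obtain F where F: "S F" "\<And>G. S G \<Longrightarrow> card G \<le> card F"
      using ex_has_greatest_nat[of S "{}" card "Suc n"] False by (auto simp: not_less le_imp_less_Suc)
    have "\<exists>a\<in>F. dist a x < r" if x: "x \<in> A" for x
    proof (rule ccontr)
      assume "\<not> ?thesis"
      then have far: "\<And>a. a \<in> F \<Longrightarrow> r \<le> dist a x" by force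
      then have "x \<notin> F" using assms by force
      moreover have "S (insert x F)"
        using F(1) far x by (auto simp: S_def dist_commute)
      ultimately show False using F(2)[of "insert x F"] F(1) by (simp add: S_def)
    qed
    then show ?thesis using F(1) by (intro net[of F]) (auto simp: S_def)
  qed
qed

text \<open>A point of \<open>A\<close> is within \<open>r\<close> of some \<open>a \<in> F\<close>, which is within \<open>r\<close> of a point \<open>b a\<close> of \<open>B\<close>.
  So the pieces that cover these finitely many \<open>b a\<close> cover \<open>A\<close> once they are thickened by
  \<open>2r\<close>. Thickening adds \<open>4r\<close> to each diameter, and there are at most \<open>(M + \<eta>)/s + 1\<close> pieces.\<close>

lemma outer_linear_measure_delta_le_of_net:
  fixes A :: "'a::metric_space set"
  assumes F: "finite F" "\<And>x. x \<in> A \<Longrightarrow> \<exists>a\<in>F. dist a x < r"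
    and B: "connected B" "hits B ((\<lambda>a. ball a r) ` F)"
    and L: "outer_linear_measure B \<le> ennreal M" and M: "0 \<le> M" and \<eta>: "0 < \<eta>"
    and s: "0 < s" and r: "0 < r" "4 * r \<le> s"
    and small: "4 * r * ((M + \<eta>) / s + 1) \<le> \<eta>"
  shows "outer_linear_measure_delta (4 * s) A \<le> ennreal (M + 2 * \<eta>)"
proof -
  have "\<exists>b. b \<in> B \<and> dist a b < r" if "a \<in> F" for a
  proof -
    have "B \<inter> ball a r \<noteq> {}" using B(2) that by (simp add: hits_def)
    then show ?thesis by auto
  qed
  then obtain b where b: "\<And>a. a \<in> F \<Longrightarrow> b a \<in> B \<and> dist a (b a) < r" by metis
  have bF: "finite (b ` F)" "b ` F \<subseteq> B" using F(1) b by auto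
  obtain ps where ps: "b ` F \<subseteq> \<Union>(fst ` set ps)" "pieces (3 * s) ps"
    "sum_list (map snd ps) \<le> M + \<eta>" "real (length ps) \<le> (M + \<eta>) / s + 1"
    using few_pieces[OF B(1) L M s \<eta> bF] by blast
  define W where "W i = (if i < length ps then thicken (2 * r) (fst (ps ! i)) else {})" for i
  have W: "ediam (W i) \<le> ennreal (snd (ps ! i) + 4 * r)" "0 \<le> snd (ps ! i)" "snd (ps ! i) \<le> 3 * s"
    if i: "i < length ps" for i
  proof -
    note piece = piecesD[OF ps(2) nth_mem[OF i]]
    show c: "0 \<le> snd (ps ! i)" "snd (ps ! i) \<le> 3 * s" using piece(2,3) .
    have "dist x y \<le> snd (ps ! i) + 2 * (2 * r)" if "x \<in> W i" "y \<in> W i" for x y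
      by (rule dist_thicken_le[where P = "fst (ps ! i)"]) (use piece(1) that i in \<open>auto simp: W_def\<close>)
    then show "ediam (W i) \<le> ennreal (snd (ps ! i) + 4 * r)"
      using c r by (subst ediam_le_iff) auto
  qed
  have "delta_cover (4 * s) A W"
    unfolding delta_cover_def
  proof (intro conjI allI subsetI)
    fix i
    show "ediam (W i) \<le> ennreal (4 * s)"
    proof (cases "i < length ps")
      case True
      then have "ennreal (snd (ps ! i) + 4 * r) \<le> ennreal (4 * s)"
        using W(3)[OF True] r by (intro ennreal_leI) linarith
      with W(1)[OF True] show ?thesis by (rule order_trans)
    qed (simp add: W_def)
  next
    fix x assume "x \<in> A"
    then obtain a where a: "a \<in> F" "dist a x < r" using F by blast
    then obtain q where q: "q \<in> set ps" "b a \<in> fst q" using ps(1) by blast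
    then obtain i where i: "i < length ps" "q = ps ! i" by (auto simp: in_set_conv_nth)
    have "dist (b a) x \<le> dist a (b a) + dist a x" by (metis dist_commute dist_triangle)
    then have "dist (b a) x < 2 * r" using a b[of a] by linarith
    then have "x \<in> W i" using q i by (auto simp: W_def thicken_def)
    then show "x \<in> (\<Union>i. W i)" by blast
  qed
  then have "outer_linear_measure_delta (4 * s) A \<le> (\<Sum>i. ediam (W i))"
    by (auto simp: outer_linear_measure_delta_def intro: INF_lower)
  also have "\<dots> = (\<Sum>i<length ps. ediam (W i))"
    by (intro suminf_finite) (auto simp: W_def)
  also have "\<dots> \<le> (\<Sum>i<length ps. ennreal (snd (ps ! i) + 4 * r))"
    using W by (intro sum_mono) auto
  also have "\<dots> = ennreal (\<Sum>i<length ps. snd (ps ! i) + 4 * r)"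
    using W r by (intro sum_ennreal) auto
  also have "(\<Sum>i<length ps. snd (ps ! i) + 4 * r) = sum_list (map snd ps) + 4 * r * length ps"
    by (simp add: sum.distrib sum_list_sum_nth atLeast0LessThan)
  also have "ennreal \<dots> \<le> ennreal (M + 2 * \<eta>)"
  proof (rule ennreal_leI)
    have "4 * r * length ps \<le> 4 * r * ((M + \<eta>) / s + 1)"
      using ps(4) r by (intro mult_left_mono) auto
    then show "sum_list (map snd ps) + 4 * r * length ps \<le> M + 2 * \<eta>" using ps(3) small by linarith
  qed
  finally show ?thesis .
qed

text \<open>The common core of the finite and the infinite case.\<close>

lemma outer_linear_measure_lower_semicontinuous:
  fixes A :: "'a::metric_space set"
  assumes M: "0 \<le> M" and A: "ennreal M < outer_linear_measure A"
  obtains \<U> where "finite \<U>" "\<And>U. U \<in> \<U> \<Longrightarrow> open U" "hits A \<U>"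
    "\<And>B. connected B \<Longrightarrow> hits B \<U> \<Longrightarrow> ennreal M < outer_linear_measure B"
proof -
  obtain \<delta> where \<delta>: "0 < \<delta>" "ennreal M < outer_linear_measure_delta \<delta> A"
    using A by (auto simp: outer_linear_measure_def less_SUP_iff)
  obtain z where z: "ennreal M < z" "z < outer_linear_measure_delta \<delta> A"
    using dense[OF \<delta>(2)] by blast
  then obtain M' where M': "ennreal M < ennreal M'" "ennreal M' < outer_linear_measure_delta \<delta> A"
    by (cases z) auto
  define \<eta> where "\<eta> = (M' - M) / 2"
  have "M + 2 * \<eta> = M'" by (simp add: \<eta>_def field_simps)
  then have \<eta>: "0 < \<eta>" "ennreal (M + 2 * \<eta>) < outer_linear_measure_delta \<delta> A"
    using M M' by (auto simp: \<eta>_def ennreal_less_iff)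
  define s where "s = \<delta> / 4"
  have s: "0 < s" "\<delta> = 4 * s" using \<delta> by (auto simp: s_def)
  define N where "N = (M + \<eta>) / s + 1"
  have N: "1 \<le> N" using M \<eta> s by (simp add: N_def)
  define r where "r = min (s / 4) (\<eta> / (4 * N))"
  have r: "0 < r" "4 * r \<le> s" using s \<eta> N by (auto simp: r_def)
  have small: "4 * r * N \<le> \<eta>"
  proof -
    have "r \<le> \<eta> / (4 * N)" by (simp add: r_def)
    then show ?thesis using N by (simp add: field_simps)
  qed
  have ball: "hits A ((\<lambda>a. ball a e) ` F)" if "F \<subseteq> A" "0 < e" for F e
    unfolding hits_def
  proof
    fix U assume "U \<in> (\<lambda>a. ball a e) ` F"
    then obtain a where "a \<in> F" "U = ball a e" by blast
    then have "a \<in> A \<inter> U" using that by auto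
    then show "A \<inter> U \<noteq> {}" by blast
  qed
  define n where "n = nat \<lceil>(M + \<eta>) / (r / 12) + 1\<rceil>"
  show thesis
    using r(1)
  proof (cases rule: net_or_many_separated_points[where A = A and n = n])
    case (net F)
    show thesis
    proof (rule that)
      show "hits A ((\<lambda>a. ball a r) ` F)" by (rule ball[OF net(2) r(1)])
      show "ennreal M < outer_linear_measure B"
        if B: "connected B" "hits B ((\<lambda>a. ball a r) ` F)" for B
      proof (rule ccontr)
        assume "\<not> ennreal M < outer_linear_measure B"
        then have "outer_linear_measure_delta (4 * s) A \<le> ennreal (M + 2 * \<eta>)"
          using outer_linear_measure_delta_le_of_net[OF net(1,3) B _ M \<eta>(1) s(1) r small[unfolded N_def]]
          by simp
        then show False using \<eta>(2) s(2) by simp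
      qed
    qed (use net in auto)
  next
    case (separated F)
    have card: "(M + \<eta>) / (r / 12) + 1 < card F"
      using separated(3) unfolding n_def by linarith
    show thesis
    proof (rule that)
      show "hits A ((\<lambda>a. ball a (r / 4)) ` F)" by (rule ball[OF separated(2)]) (use r in simp)
      show "ennreal M < outer_linear_measure B"
        if "connected B" "hits B ((\<lambda>a. ball a (r / 4)) ` F)" for B
        by (rule many_separated_points[OF separated(1) _ r(1) M \<eta>(1) card that]) (rule separated(4))
    qed (use separated in auto)
  qed
qed

theorem theorem5:
  fixes A :: "'a::metric_space set"
  shows "(outer_linear_measure A < \<infinity> \<longrightarrow>
           (\<forall>\<epsilon>::real. \<epsilon> > 0 \<longrightarrow>
             (\<exists>\<U>::'a set set. finite \<U> \<and> (\<forall>U\<in>\<U>. open U) \<and> hits A \<U> \<and>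
               (\<forall>B::'a set. connected B \<and> hits B \<U> \<longrightarrow>
                 outer_linear_measure A < outer_linear_measure B + ennreal \<epsilon>)))) \<and>
         (outer_linear_measure A = \<infinity> \<longrightarrow>
           (\<forall>M::real. M > 0 \<longrightarrow>
             (\<exists>\<U>::'a set set. finite \<U> \<and> (\<forall>U\<in>\<U>. open U) \<and> hits A \<U> \<and>
               (\<forall>B::'a set. connected B \<and> hits B \<U> \<longrightarrow>
                 outer_linear_measure B > ennreal M))))"
proof (intro conjI impI allI)
  fix \<epsilon> :: real
  assume fin: "outer_linear_measure A < \<infinity>" and \<epsilon>: "0 < \<epsilon>"
  obtain l where l: "outer_linear_measure A = ennreal l" "0 \<le> l"
    using fin by (cases "outer_linear_measure A") auto
  show "\<exists>\<U>::'a set set. finite \<U> \<and> (\<forall>U\<in>\<U>. open U) \<and> hits A \<U> \<and>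
      (\<forall>B. connected B \<and> hits B \<U> \<longrightarrow> outer_linear_measure A < outer_linear_measure B + ennreal \<epsilon>)"
  proof (cases "l < \<epsilon>")
    case True
    \<comment> \<open>Here \<open>\<epsilon>\<close> alone exceeds the measure of \<open>A\<close>, so the empty family will do.\<close>
    have "outer_linear_measure A < outer_linear_measure B + ennreal \<epsilon>" for B :: "'a set"
    proof -
      have "outer_linear_measure A < ennreal \<epsilon>" using True l by (simp add: ennreal_less_iff)
      also have "\<dots> \<le> outer_linear_measure B + ennreal \<epsilon>" by simp
      finally show ?thesis .
    qed
    then show ?thesis by (intro exI[of _ "{}"]) (simp add: hits_def)
  next
    case False
    define M where "M = l - \<epsilon> / 2"
    have M: "0 \<le> M" "ennreal M < outer_linear_measure A"
      using False \<epsilon> l by (auto simp: M_def ennreal_less_iff)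
    obtain \<U> :: "'a set set" where \<U>: "finite \<U>" "\<And>U. U \<in> \<U> \<Longrightarrow> open U" "hits A \<U>"
      "\<And>B. connected B \<Longrightarrow> hits B \<U> \<Longrightarrow> ennreal M < outer_linear_measure B"
      by (fact outer_linear_measure_lower_semicontinuous[OF M])
    have "outer_linear_measure A < outer_linear_measure B + ennreal \<epsilon>"
      if "connected B" "hits B \<U>" for B
    proof -
      have "outer_linear_measure A < ennreal (M + \<epsilon>)"
        using l M \<epsilon> by (simp add: ennreal_less_iff M_def)
      also have "\<dots> = ennreal M + ennreal \<epsilon>" using M \<epsilon> by (simp add: ennreal_plus)
      also have "\<dots> \<le> outer_linear_measure B + ennreal \<epsilon>"
        using \<U>(4)[OF that] by (intro add_mono) auto
      finally show ?thesis .
    qed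
    with \<U>(1-3) show ?thesis by (intro exI[of _ \<U>]) simp
  qed
next
  fix M :: real
  assume "outer_linear_measure A = \<infinity>" and "0 < M"
  then have M: "0 \<le> M" "ennreal M < outer_linear_measure A" by simp_all
  obtain \<U> :: "'a set set" where "finite \<U>" "\<And>U. U \<in> \<U> \<Longrightarrow> open U" "hits A \<U>"
    "\<And>B. connected B \<Longrightarrow> hits B \<U> \<Longrightarrow> ennreal M < outer_linear_measure B"
    by (fact outer_linear_measure_lower_semicontinuous[OF M])
  then show "\<exists>\<U>::'a set set. finite \<U> \<and> (\<forall>U\<in>\<U>. open U) \<and> hits A \<U> \<and>
      (\<forall>B. connected B \<and> hits B \<U> \<longrightarrow> ennreal M < outer_linear_measure B)"
    by (intro exI[of _ \<U>]) simp
qed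

end
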